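(* Let $U,V\subseteq\mathbb{R}^n$ be linear subspaces, let $\gamma,\beta\in\mathbb{R}$ with $\mu:=\gamma+\beta\in(0,1)$, and assume $V\not\subset U$. Let $L_{\gamma,\beta}:=C_{T,\gamma,\beta}\circ P_V$, where $C_{T,\gamma,\beta}:=(1-\gamma-\beta)\,\mathrm{Id}+\beta R_VR_U+\gamma R_U$. The iterates $L_{\gamma,\beta}^k(x)$ converge to $P_{U\cap V}(x)$ from every $x\in\mathbb{R}^n$, with optimal asymptotic linear rate $$\Gamma_\circ(\mu):=\max\bigl\{|1-2\mu\sin^2\theta_F|,\ |1-2\mu\sin^2\theta_p|\bigr\}.$$ The minimum over $\mu\in(0,1)$ is attained at $$\mu^\star=\frac{1}{\sin^2\theta_F+\sin^2\theta_p}=\frac{1}{a+b},$$ with $\min_{\mu\in(0,1)}\Gamma_\circ(\mu)=\rho_V$, where $a:=\sin^2\theta_F$, $b:=\sin^2\theta_p$ and $\rho_V:=\dfrac{\sin^2\theta_p-\sin^2\theta_F}{\sin^2\theta_p+\sin^2\theta_F}=\dfrac{b-a}{b+a}$. Hence any $(\gamma,\beta)$ with $\gamma+\beta=\mu^\star=1/(a+b)$ yields the rate $\rho_V$; in particular, $\gamma^\star=\beta^\star=\dfrac{1}{2(a+b)}$ does so.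
   Context: For a linear subspace $W\subseteq\mathbb{R}^n$, $P_W$ is the orthogonal projection onto $W$ and $R_W=2P_W-\mathrm{Id}$ is the reflection across $W$. Put $p=\dim V$ and $s=\dim(U\cap V)$, so $s<p$ since $V\not\subset U$. Principal angles: let $\sigma_1\ge\dots\ge\sigma_p\ge0$ be the singular values of $P_U|_V:V\to\mathbb{R}^n$ and $\theta_k=\arccos\sigma_k$, so $0\le\theta_1\le\dots\le\theta_p\le\pi/2$; the first $s$ of them are $0$. The Friedrichs angle is $\theta_F:=\theta_{s+1}\in(0,\pi/2]$, and $\theta_p$ is the largest principal angle. For a linear operator $L$ on $\mathbb{R}^n$ with $L^k\to L^\infty$, a number $r\in[0,1)$ is a linear convergence rate if there are $m>0$ and $N\in\mathbb{N}$ with $\|L^k-L^\infty\|\le m\,r^k$ for all $k\ge N$; the optimal asymptotic linear rate is the infimum of all such $r$.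
   Formalization: Minimality of μ* over (0,1) is claimed only if μ*=1/(a+b) lies in (0,1), i.e. a+b>1; otherwise it fails (two lines at angle π/6: a=b=1/4, μ*=2). Minimality over all μ>0 is proved unconditionally, as is the rate ρ_V at μ*. *)

theory Defs
  imports "HOL-Analysis.Analysis" "HOL-Library.Multiset"
begin

definition orth_proj :: "'a::euclidean_space set \<Rightarrow> 'a \<Rightarrow> 'a" where
  "orth_proj W x = (THE y. y \<in> W \<and> (\<forall>w\<in>W. orthogonal (x - y) w))"

definition reflection :: "'a::euclidean_space set \<Rightarrow> 'a \<Rightarrow> 'a" where
  "reflection W x = 2 *\<^sub>R orth_proj W x - x"

text \<open>
  The adjoint of the restriction of \<open>f\<close> to a subspace \<open>V\<close>, as a map into \<open>V\<close>, is the adjoint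
  of \<open>f\<close> followed by the orthogonal projection onto \<open>V\<close>.  Hence \<open>gram_eigenspace f V l\<close> is the
  eigenspace of \<open>A\<^sup>* A\<close> for \<open>l\<close>, where \<open>A\<close> is the restriction of \<open>f\<close> to \<open>V\<close>.
\<close>

definition gram_eigenspace ::
    "('a::euclidean_space \<Rightarrow> 'b::euclidean_space) \<Rightarrow> 'a set \<Rightarrow> real \<Rightarrow> 'a set" where
  "gram_eigenspace f V l = {x \<in> V. orth_proj V (adjoint f (f x)) = l *\<^sub>R x}"

text \<open>
  The singular values of \<open>A\<close> (square roots of the eigenvalues of \<open>A\<^sup>* A\<close>, zero included),
  repeated according to multiplicity and listed in decreasing order.  As \<open>A\<^sup>* A\<close> is self-adjoint,
  the multiplicity of an eigenvalue is the dimension of its eigenspace, and for linear \<open>f\<close> the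
  list has length \<open>dim V\<close>.
\<close>

definition singular_values ::
    "('a::euclidean_space \<Rightarrow> 'b::euclidean_space) \<Rightarrow> 'a set \<Rightarrow> real list" where
  "singular_values f V =
     rev (sorted_list_of_multiset
       (\<Sum>\<sigma> | 0 \<le> \<sigma> \<and> gram_eigenspace f V (\<sigma>\<^sup>2) \<noteq> {0}.
          replicate_mset (dim (gram_eigenspace f V (\<sigma>\<^sup>2))) \<sigma>))"

text \<open>Principal angles are numbered from \<open>1\<close> to \<open>dim V\<close>, list positions from \<open>0\<close>.\<close>

definition principal_angle :: "'a::euclidean_space set \<Rightarrow> 'a set \<Rightarrow> nat \<Rightarrow> real" where
  "principal_angle U V k = arccos (singular_values (orth_proj U) V ! (k - 1))"

definition friedrichs_angle :: "'a::euclidean_space set \<Rightarrow> 'a set \<Rightarrow> real" where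
  "friedrichs_angle U V = principal_angle U V (dim (U \<inter> V) + 1)"

definition largest_angle :: "'a::euclidean_space set \<Rightarrow> 'a set \<Rightarrow> real" where
  "largest_angle U V = principal_angle U V (dim V)"

definition C_op :: "'a::euclidean_space set \<Rightarrow> 'a set \<Rightarrow> real \<Rightarrow> real \<Rightarrow> 'a \<Rightarrow> 'a" where
  "C_op U V \<gamma> \<beta> x =
     (1 - \<gamma> - \<beta>) *\<^sub>R x + \<beta> *\<^sub>R reflection V (reflection U x) + \<gamma> *\<^sub>R reflection U x"

definition L_op :: "'a::euclidean_space set \<Rightarrow> 'a set \<Rightarrow> real \<Rightarrow> real \<Rightarrow> 'a \<Rightarrow> 'a" where
  "L_op U V \<gamma> \<beta> = C_op U V \<gamma> \<beta> \<circ> orth_proj V"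

definition linear_conv_rate ::
    "('a::euclidean_space \<Rightarrow> 'a) \<Rightarrow> ('a \<Rightarrow> 'a) \<Rightarrow> real \<Rightarrow> bool" where
  "linear_conv_rate L L_inf r \<longleftrightarrow>
     0 \<le> r \<and> r < 1 \<and>
     (\<exists>m>0. \<exists>N. \<forall>k\<ge>N. onorm (\<lambda>x. (L ^^ k) x - L_inf x) \<le> m * r ^ k)"

text \<open>
  The infimum of the empty set of reals is an arbitrary number, so the existence of some linear
  convergence rate (which also forces \<open>L ^^ k\<close> to converge to \<open>L_inf\<close>) is made explicit.
\<close>

definition has_optimal_rate ::
    "('a::euclidean_space \<Rightarrow> 'a) \<Rightarrow> ('a \<Rightarrow> 'a) \<Rightarrow> real \<Rightarrow> bool" where
  "has_optimal_rate L L_inf \<rho> \<longleftrightarrow>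
     (\<exists>r. linear_conv_rate L L_inf r) \<and> \<rho> = Inf {r. linear_conv_rate L L_inf r}"

definition Gamma_circ :: "'a::euclidean_space set \<Rightarrow> 'a set \<Rightarrow> real \<Rightarrow> real" where
  "Gamma_circ U V \<mu> =
     max \<bar>1 - 2 * \<mu> * (sin (friedrichs_angle U V))\<^sup>2\<bar> \<bar>1 - 2 * \<mu> * (sin (largest_angle U V))\<^sup>2\<bar>"

end

theory Submission
  imports Defs
begin

text \<open>
  Write \<open>P\<close> and \<open>Q\<close> for the orthogonal projections onto \<open>U\<close> and \<open>V\<close>, and \<open>\<mu> = \<gamma> + \<beta>\<close>.
  The individual parameters matter little because the operator restarts from \<open>V\<close> in every step:
  for \<open>v\<close> in \<open>V\<close> the point \<open>C v\<close> is a combination of \<open>v\<close>, \<open>Q P v\<close> and \<open>P v\<close>, and a further \<open>Q\<close>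
  turns it into \<open>(1 - 2 \<mu>) v + 2 \<mu> Q P v\<close>.  So the iteration seen from \<open>V\<close> is governed by the
  compression \<open>Q P\<close> of \<open>P\<close> to \<open>V\<close>, which is self-adjoint and therefore has an orthonormal
  eigenbasis \<open>B\<close> of \<open>V\<close> (\<open>principal_basis_exists\<close>).  The eigenvalue of \<open>b \<in> B\<close> is
  \<open>(norm (P b))\<^sup>2\<close>, the squared cosine of a principal angle \<open>\<theta>\<close>, so that \<open>Q C\<close> multiplies \<open>b\<close> by
  \<open>1 - 2 \<mu> sin\<^sup>2 \<theta>\<close> (\<open>proj_C_op_principal_vector\<close>).

  The basis vectors in \<open>U\<close> are those with \<open>\<theta> = 0\<close>, and they span \<open>U \<inter> V\<close>.  Those outside \<open>U\<close>
  span the part of \<open>V\<close> in which the error lives.  Among them the smallest angle is the Friedrichs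
  angle and the largest is the largest principal angle; this is the content of
  \<open>friedrichs_and_largest_angle\<close>, which reads the two angles off the sorted list of singular
  values.  As \<open>t \<mapsto> \<bar>1 - 2 \<mu> t\<bar>\<close> is convex, the largest modulus of a multiplier is attained at one of
  these two angles and equals \<open>Gamma_circ U V \<mu>\<close>.  It is a rate because the error stays in the span
  of these vectors and shrinks by that factor in every step (\<open>linear_conv_rate_upper\<close>), and no
  smaller number is a rate because of the corresponding eigenvector (\<open>linear_conv_rate_lower\<close>).

  All multipliers have modulus below one as soon as \<open>0 < \<mu>\<close> and \<open>\<mu> b < 1\<close>, where \<open>a\<close> and \<open>b\<close> are
  the squared sines of the Friedrichs angle and of the largest angle.  This covers both \<open>\<mu> \<in> {0<..<1}\<close> and \<open>\<mu> = 1 / (a + b)\<close>, and the latter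
  need not be below one.  At \<open>\<mu> = 1 / (a + b)\<close> the two extreme multipliers are opposite numbers,
  and a weighted mean of the two shows that no \<open>\<mu>\<close> does better (\<open>equioscillation_minimal\<close>).
\<close>

section \<open>Orthogonal projections\<close>

lemma orth_proj_eqI:
  assumes "subspace W" "y \<in> W" "\<And>w. w \<in> W \<Longrightarrow> (x - y) \<bullet> w = 0"
  shows "orth_proj W x = y"
  unfolding orth_proj_def
proof (rule the_equality)
  show "y \<in> W \<and> (\<forall>w\<in>W. orthogonal (x - y) w)"
    using assms by (simp add: orthogonal_def)
next
  fix z assume z: "z \<in> W \<and> (\<forall>w\<in>W. orthogonal (x - z) w)"
  have "z - y \<in> W" using z assms by (simp add: subspace_diff)
  then have "(x - y) \<bullet> (z - y) = 0" "(x - z) \<bullet> (z - y) = 0"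
    using assms z by (auto simp: orthogonal_def)
  then have "(z - y) \<bullet> (z - y) = 0" by (simp add: inner_diff_left)
  then show "z = y" by simp
qed

lemma
  assumes W: "subspace W"
  shows orth_proj_mem: "orth_proj W x \<in> W"
    and orth_proj_residual: "w \<in> W \<Longrightarrow> (x - orth_proj W x) \<bullet> w = 0"
proof -
  obtain y z where yz: "y \<in> span W" "\<And>w. w \<in> span W \<Longrightarrow> orthogonal z w" "x = y + z"
    using orthogonal_subspace_decomp_exists[of W x] by metis
  have "orth_proj W x = y"
    using yz W by (intro orth_proj_eqI) (auto simp: orthogonal_def span_eq_iff[THEN iffD2])
  then show "orth_proj W x \<in> W" "w \<in> W \<Longrightarrow> (x - orth_proj W x) \<bullet> w = 0"
    using yz W by (auto simp: orthogonal_def span_eq_iff[THEN iffD2])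
qed

lemma orth_proj_ident: "subspace W \<Longrightarrow> x \<in> W \<Longrightarrow> orth_proj W x = x"
  by (rule orth_proj_eqI) auto

lemma linear_orth_proj:
  assumes W: "subspace W"
  shows "linear (orth_proj W)"
proof (rule linearI)
  fix x y
  show "orth_proj W (x + y) = orth_proj W x + orth_proj W y"
  proof (rule orth_proj_eqI[OF W])
    show "orth_proj W x + orth_proj W y \<in> W" by (simp add: W orth_proj_mem subspace_add)
    fix w assume "w \<in> W"
    then show "(x + y - (orth_proj W x + orth_proj W y)) \<bullet> w = 0"
      using orth_proj_residual[OF W, of w x] orth_proj_residual[OF W, of w y]
      by (simp add: algebra_simps inner_diff_left inner_add_left)
  qed
next
  fix c x
  show "orth_proj W (c *\<^sub>R x) = c *\<^sub>R orth_proj W x"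
  proof (rule orth_proj_eqI[OF W])
    show "c *\<^sub>R orth_proj W x \<in> W" by (simp add: W orth_proj_mem subspace_scale)
    fix w assume "w \<in> W"
    then show "(c *\<^sub>R x - c *\<^sub>R orth_proj W x) \<bullet> w = 0"
      using orth_proj_residual[OF W, of w x] by (simp add: inner_diff_left)
  qed
qed

lemma orth_proj_selfadjoint:
  assumes W: "subspace W"
  shows "orth_proj W x \<bullet> y = x \<bullet> orth_proj W y"
proof -
  have "(x - orth_proj W x) \<bullet> orth_proj W y = 0" "(y - orth_proj W y) \<bullet> orth_proj W x = 0"
    by (simp_all add: W orth_proj_mem orth_proj_residual)
  then show ?thesis
    by (simp add: inner_diff_left inner_commute[of y] inner_commute[of "orth_proj W y"])
qed

lemma adjoint_orth_proj: "subspace W \<Longrightarrow> adjoint (orth_proj W) = orth_proj W"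
  by (rule adjoint_unique) (simp add: orth_proj_selfadjoint)

lemma norm_orth_proj_pythagoras:
  assumes W: "subspace W"
  shows "(norm x)\<^sup>2 = (norm (orth_proj W x))\<^sup>2 + (norm (x - orth_proj W x))\<^sup>2"
proof -
  have "orthogonal (orth_proj W x) (x - orth_proj W x)"
    using orth_proj_residual[OF W orth_proj_mem[OF W], of x x]
    by (simp add: orthogonal_def inner_commute)
  then show ?thesis using norm_add_Pythagorean by fastforce
qed

lemma norm_orth_proj_le: "subspace W \<Longrightarrow> norm (orth_proj W x) \<le> norm x"
  using norm_orth_proj_pythagoras[of W x]
  by (metis le_add_same_cancel1 norm_ge_zero power2_le_imp_le zero_le_power2)

lemma norm_orth_proj_eq_iff:
  assumes W: "subspace W"
  shows "norm (orth_proj W x) = norm x \<longleftrightarrow> x \<in> W"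
proof
  assume "norm (orth_proj W x) = norm x"
  then have "x = orth_proj W x" using norm_orth_proj_pythagoras[OF W, of x] by simp
  then show "x \<in> W" using orth_proj_mem[OF W] by metis
qed (simp add: orth_proj_ident W)

section \<open>Diagonalising a self-adjoint map on a subspace\<close>

lemma orthonormal_expansion:
  fixes B :: "'a::euclidean_space set"
  assumes B: "pairwise orthogonal B" "\<And>b. b \<in> B \<Longrightarrow> norm b = 1" and x: "x \<in> span B"
  shows "x = (\<Sum>b\<in>B. (x \<bullet> b) *\<^sub>R b)"
proof -
  have fin: "finite B" by (rule pairwise_orthogonal_imp_finite[OF B(1)])
  have "orth_proj (span B) x = (\<Sum>b\<in>B. (x \<bullet> b) *\<^sub>R b)"
  proof (rule orth_proj_eqI)
    show "(\<Sum>b\<in>B. (x \<bullet> b) *\<^sub>R b) \<in> span B" by (simp add: span_base span_scale span_sum)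
    fix w assume "w \<in> span B"
    then show "(x - (\<Sum>b\<in>B. (x \<bullet> b) *\<^sub>R b)) \<bullet> w = 0"
    proof (rule span_induct)
      show "subspace {w. (x - (\<Sum>b\<in>B. (x \<bullet> b) *\<^sub>R b)) \<bullet> w = 0}"
        by (rule subspace_hyperplane)
      fix c assume c: "c \<in> B"
      have "(\<Sum>b\<in>B. (x \<bullet> b) * (b \<bullet> c)) = (\<Sum>b\<in>B. if b = c then x \<bullet> c else 0)"
        using B c by (intro sum.cong) (auto simp: pairwise_def orthogonal_def dot_square_norm)
      then show "(x - (\<Sum>b\<in>B. (x \<bullet> b) *\<^sub>R b)) \<bullet> c = 0"
        using c fin by (simp add: inner_diff_left inner_sum_left)
    qed
  qed simp
  then show ?thesis using x by (simp add: orth_proj_ident)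
qed

lemma orthonormal_norm_sum:
  fixes B :: "'a::euclidean_space set"
  assumes B: "pairwise orthogonal B" "\<And>b. b \<in> B \<Longrightarrow> norm b = 1"
  shows "(norm (\<Sum>b\<in>B. c b *\<^sub>R b))\<^sup>2 = (\<Sum>b\<in>B. (c b)\<^sup>2)"
proof -
  have fin: "finite B" by (rule pairwise_orthogonal_imp_finite[OF B(1)])
  have "(norm (\<Sum>b\<in>B. c b *\<^sub>R b))\<^sup>2 = (\<Sum>b\<in>B. (norm (c b *\<^sub>R b))\<^sup>2)"
    using B(1) fin
    by (intro norm_sum_Pythagorean) (auto simp: pairwise_def orthogonal_def)
  then show ?thesis using B(2) by simp
qed

lemma in_span_orthonormal_subset:
  fixes B :: "'a::euclidean_space set"
  assumes B: "pairwise orthogonal B" "\<And>b. b \<in> B \<Longrightarrow> norm b = 1"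
    and x: "x \<in> span B" and C: "C \<subseteq> B" and zero: "\<And>b. b \<in> B - C \<Longrightarrow> x \<bullet> b = 0"
  shows "x \<in> span C"
proof -
  have fin: "finite B" by (rule pairwise_orthogonal_imp_finite[OF B(1)])
  have "x = (\<Sum>b\<in>B. (x \<bullet> b) *\<^sub>R b)" by (rule orthonormal_expansion[OF B x])
  also have "\<dots> = (\<Sum>b\<in>C. (x \<bullet> b) *\<^sub>R b)"
    using fin C zero by (intro sum.mono_neutral_right) auto
  also have "\<dots> \<in> span C" by (simp add: span_base span_scale span_sum)
  finally show ?thesis .
qed

text \<open>
  A maximiser \<open>e\<close> of the Rayleigh quotient on the compact unit sphere of \<open>V\<close> is an eigenvector.  With
  \<open>l\<close> the maximum, the quadratic form \<open>q y = l (y \<bullet> y) - T y \<bullet> y\<close> is nonnegative and vanishes at \<open>e\<close>.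
  If \<open>z = l e - T e\<close> were nonzero, moving from \<open>e\<close> a little in the direction \<open>- z\<close> would make \<open>q\<close>
  negative.
\<close>

lemma selfadjoint_has_eigenvector:
  fixes T :: "'a::euclidean_space \<Rightarrow> 'a"
  assumes V: "subspace V" and ne: "V \<noteq> {0}" and T: "linear T" "T ` V \<subseteq> V"
    and sa: "\<And>x y. x \<in> V \<Longrightarrow> y \<in> V \<Longrightarrow> T x \<bullet> y = x \<bullet> T y"
  obtains e l where "e \<in> V" "norm e = 1" "T e = l *\<^sub>R e"
proof -
  define K where "K = V \<inter> sphere 0 1"
  have "compact K" unfolding K_def
    by (simp add: V closed_Int_compact closed_subspace)
  moreover have "K \<noteq> {}"
  proof -
    obtain x where x: "x \<in> V" "x \<noteq> 0" using ne subspace_0[OF V] by auto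
    then have "x /\<^sub>R norm x \<in> K" by (simp add: K_def V subspace_scale)
    then show ?thesis by auto
  qed
  moreover have "continuous_on K (\<lambda>x. T x \<bullet> x)"
    by (intro continuous_intros linear_continuous_on_compose[OF _ T(1)])
  ultimately obtain e where e: "e \<in> K" and max: "\<And>y. y \<in> K \<Longrightarrow> T y \<bullet> y \<le> T e \<bullet> e"
    using continuous_attains_sup[of K "\<lambda>x. T x \<bullet> x"] by blast
  have eV: "e \<in> V" and en: "e \<bullet> e = 1" using e by (auto simp: K_def dot_square_norm)
  define l where "l = T e \<bullet> e"
  define q where "q y = l * (y \<bullet> y) - T y \<bullet> y" for y
  have q_nonneg: "0 \<le> q y" if y: "y \<in> V" for y
  proof (cases "y = 0")
    case True then show ?thesis by (simp add: q_def)
  next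
    case False
    have "y /\<^sub>R norm y \<in> K" using y False by (simp add: K_def V subspace_scale)
    from max[OF this] have "(T y \<bullet> y) / (norm y)\<^sup>2 \<le> l"
      by (simp add: l_def linear_cmul[OF T(1)] power2_eq_square field_simps)
    then show ?thesis using False
      by (simp add: q_def dot_square_norm pos_divide_le_eq)
  qed
  define z where "z = l *\<^sub>R e - T e"
  have zV: "z \<in> V" using eV T(2) by (auto simp: z_def V subspace_diff subspace_scale)
  have q_line: "q (e - t *\<^sub>R z) = t\<^sup>2 * q z - 2 * t * (z \<bullet> z)" for t
  proof -
    have "q (e - t *\<^sub>R z) = l * (e \<bullet> e - 2 * t * (z \<bullet> e) + t\<^sup>2 * (z \<bullet> z))
        - (T e \<bullet> e - t * (T e \<bullet> z) - t * (T z \<bullet> e) + t\<^sup>2 * (T z \<bullet> z))"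
      by (simp add: q_def linear_diff[OF T(1)] linear_cmul[OF T(1)] inner_diff_left
          inner_diff_right inner_commute[of e z] power2_eq_square algebra_simps)
    moreover have "T z \<bullet> e = z \<bullet> T e" using sa zV eV by simp
    moreover have "T e \<bullet> z = z \<bullet> T e" by (rule inner_commute)
    moreover have "z \<bullet> T e = l * (z \<bullet> e) - z \<bullet> z"
      by (subst (3) z_def) (simp add: inner_diff_right)
    moreover have "T e \<bullet> e = l" by (simp add: l_def)
    ultimately have "q (e - t *\<^sub>R z) = l * (1 - 2 * t * (z \<bullet> e) + t\<^sup>2 * (z \<bullet> z))
        - (l - 2 * t * (l * (z \<bullet> e) - z \<bullet> z) + t\<^sup>2 * (T z \<bullet> z))"
      by (simp add: en algebra_simps)
    then show ?thesis by (simp add: q_def algebra_simps)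
  qed
  \<comment> \<open>Any positive \<open>t\<close> with \<open>t * q z < 2 * (z \<bullet> z)\<close> makes \<open>q\<close> negative on the line;
      the summand \<open>1\<close> avoids division by zero.\<close>
  define t where "t = (z \<bullet> z) / (q z + 1)"
  have qz: "0 \<le> q z" by (rule q_nonneg[OF zV])
  have "0 \<le> q (e - t *\<^sub>R z)" by (rule q_nonneg) (simp add: V eV zV subspace_diff subspace_scale)
  then have "0 \<le> t * (t * q z - 2 * (z \<bullet> z))"
    by (simp add: q_line power2_eq_square algebra_simps)
  moreover have "t * q z \<le> z \<bullet> z" using qz by (simp add: t_def field_simps)
  moreover have "0 < t" if "z \<noteq> 0" using that qz by (simp add: t_def)
  ultimately have "z = 0"
    by (smt (verit) inner_gt_zero_iff zero_le_mult_iff)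
  then have "T e = l *\<^sub>R e" by (simp add: z_def)
  with eV e that show thesis by (auto simp: K_def)
qed

text \<open>
  Self-adjointness makes the orthogonal complement in \<open>V\<close> of an eigenvector invariant under \<open>T\<close>, so
  eigenvectors can be split off one dimension at a time.
\<close>

lemma selfadjoint_orthonormal_eigenbasis:
  fixes T :: "'a::euclidean_space \<Rightarrow> 'a"
  assumes "linear T" "subspace V" "T ` V \<subseteq> V"
    and "\<And>x y. x \<in> V \<Longrightarrow> y \<in> V \<Longrightarrow> T x \<bullet> y = x \<bullet> T y"
  shows "\<exists>B. pairwise orthogonal B \<and> (\<forall>b\<in>B. norm b = 1) \<and> span B = V \<and>
             (\<forall>b\<in>B. \<exists>l. T b = l *\<^sub>R b)"
  using assms
proof (induction "dim V" arbitrary: V rule: less_induct)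
  case less
  note T = less.prems(1,3) and V = less.prems(2) and sa = less.prems(4)
  show ?case
  proof (cases "V = {0}")
    case True
    then show ?thesis by (intro exI[of _ "{}"]) auto
  next
    case False
    obtain e l where e: "e \<in> V" "norm e = 1" and eig: "T e = l *\<^sub>R e"
      using selfadjoint_has_eigenvector[OF V False T sa] by metis
    define V' where "V' = {x \<in> V. x \<bullet> e = 0}"
    have V': "subspace V'" using V
      by (auto simp: V'_def subspace_def inner_add_left)
    have "e \<notin> V'" using e by (simp add: V'_def dot_square_norm)
    then have "V' \<noteq> V" using e by blast
    then have "V' \<subset> V" by (auto simp: V'_def)
    then have "dim V' < dim V" using V V' by (simp add: dim_psubset span_eq_iff[THEN iffD2])
    moreover have "T ` V' \<subseteq> V'"
    proof clarify
      fix x assume x: "x \<in> V'"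
      then have "T x \<bullet> e = x \<bullet> T e" using sa e by (auto simp: V'_def)
      then show "T x \<in> V'" using x T by (auto simp: V'_def eig)
    qed
    moreover have "T x \<bullet> y = x \<bullet> T y" if "x \<in> V'" "y \<in> V'" for x y
      using that sa by (simp add: V'_def)
    ultimately obtain B where B: "pairwise orthogonal B" "\<forall>b\<in>B. norm b = 1" "span B = V'"
        "\<forall>b\<in>B. \<exists>l. T b = l *\<^sub>R b"
      using less.hyps[of V'] T(1) V' by blast
    have BV': "B \<subseteq> V'" using B(3) span_superset by blast
    have "V \<subseteq> span (insert e B)"
    proof
      fix x assume x: "x \<in> V"
      have "x - (x \<bullet> e) *\<^sub>R e \<in> V'"
        using x e V by (simp add: V'_def subspace_diff subspace_scale inner_diff_left dot_square_norm)
      then show "x \<in> span (insert e B)" using B(3) span_breakdown_eq by blast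
    qed
    moreover have "span (insert e B) \<subseteq> V"
      using e BV' V by (intro span_minimal) (auto simp: V'_def)
    ultimately have "span (insert e B) = V" by blast
    moreover have "pairwise orthogonal (insert e B)"
      using B(1) BV' by (auto simp: pairwise_insert V'_def orthogonal_def inner_commute)
    ultimately show ?thesis using B e eig by (intro exI[of _ "insert e B"]) auto
  qed
qed

section \<open>Principal vectors and principal angles\<close>

text \<open>
  The members of such a basis are the principal vectors of \<open>V\<close> relative to \<open>U\<close>, that is, the right
  singular vectors of the restriction to \<open>V\<close> of the projection onto \<open>U\<close>.  The eigenvalue can be
  written as a squared norm because \<open>Q P b = l b\<close> with \<open>b\<close> a unit vector in \<open>V\<close> gives
  \<open>l = Q P b \<bullet> b = P b \<bullet> b = P b \<bullet> P b\<close>.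
\<close>

definition principal_basis :: "'a::euclidean_space set \<Rightarrow> 'a set \<Rightarrow> 'a set \<Rightarrow> bool" where
  "principal_basis U V B \<longleftrightarrow>
     pairwise orthogonal B \<and> (\<forall>b\<in>B. norm b = 1) \<and> span B = V \<and>
     (\<forall>b\<in>B. orth_proj V (orth_proj U b) = (norm (orth_proj U b))\<^sup>2 *\<^sub>R b)"

lemma principal_basisD:
  assumes "principal_basis U V B"
  shows "pairwise orthogonal B" "b \<in> B \<Longrightarrow> norm b = 1" "span B = V" "subspace V"
    "finite B" "b \<in> B \<Longrightarrow> b \<in> V"
    "b \<in> B \<Longrightarrow> orth_proj V (orth_proj U b) = (norm (orth_proj U b))\<^sup>2 *\<^sub>R b"
    "C \<subseteq> B \<Longrightarrow> independent C"
proof -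
  show B: "pairwise orthogonal B" "b \<in> B \<Longrightarrow> norm b = 1" "span B = V" "subspace V"
      "b \<in> B \<Longrightarrow> b \<in> V"
      "b \<in> B \<Longrightarrow> orth_proj V (orth_proj U b) = (norm (orth_proj U b))\<^sup>2 *\<^sub>R b" for b
    using assms by (auto simp: principal_basis_def intro: span_base)
  show "finite B" by (rule pairwise_orthogonal_imp_finite[OF B(1)])
  assume C: "C \<subseteq> B"
  have "pairwise orthogonal C" by (rule pairwise_subset[OF B(1) C])
  moreover have "0 \<notin> C" using C B(2) by fastforce
  ultimately show "independent C" by (rule pairwise_orthogonal_independent)
qed

lemma compression_selfadjoint:
  assumes U: "subspace U" and V: "subspace V" and xy: "x \<in> V" "y \<in> V"
  shows "orth_proj V (orth_proj U x) \<bullet> y = x \<bullet> orth_proj V (orth_proj U y)"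
  by (metis U V orth_proj_ident orth_proj_selfadjoint xy)

lemma principal_basis_exists:
  assumes U: "subspace U" and V: "subspace V"
  obtains B where "principal_basis U V B"
proof -
  let ?T = "\<lambda>x. orth_proj V (orth_proj U x)"
  have "linear ?T"
    using linear_compose[OF linear_orth_proj[OF U] linear_orth_proj[OF V]] by (simp add: o_def)
  moreover have "?T ` V \<subseteq> V" using orth_proj_mem[OF V] by auto
  ultimately obtain B where B: "pairwise orthogonal B" "\<forall>b\<in>B. norm b = 1" "span B = V"
      and eig: "\<forall>b\<in>B. \<exists>l. ?T b = l *\<^sub>R b"
    using selfadjoint_orthonormal_eigenbasis[of ?T V] V compression_selfadjoint[OF U V] by blast
  have "?T b = (norm (orth_proj U b))\<^sup>2 *\<^sub>R b" if b: "b \<in> B" for b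
  proof -
    obtain l where l: "?T b = l *\<^sub>R b" using eig b by blast
    have bV: "b \<in> V" using b B(3) span_base by blast
    have "l = ?T b \<bullet> b" using l B(2) b by (simp add: dot_square_norm)
    also have "\<dots> = orth_proj U b \<bullet> b"
      by (simp add: V bV orth_proj_ident orth_proj_selfadjoint)
    also have "\<dots> = orth_proj U b \<bullet> orth_proj U b"
      by (metis U orth_proj_ident orth_proj_mem orth_proj_selfadjoint)
    finally show ?thesis using l by (simp add: dot_square_norm)
  qed
  then show thesis using B by (intro that[of B]) (simp add: principal_basis_def)
qed

text \<open>
  Eigenvectors of the self-adjoint compression for distinct eigenvalues are orthogonal, so an
  eigenvector for \<open>l\<close> has no component along basis vectors with a different eigenvalue.
\<close>

lemma gram_eigenspace_principal_basis:
  assumes U: "subspace U" and B: "principal_basis U V B"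
  shows "gram_eigenspace (orth_proj U) V l = span {b \<in> B. (norm (orth_proj U b))\<^sup>2 = l}"
proof -
  note B' = principal_basisD[OF B]
  let ?E = "{b \<in> B. (norm (orth_proj U b))\<^sup>2 = l}"
  have gram: "gram_eigenspace (orth_proj U) V l = {x \<in> V. orth_proj V (orth_proj U x) = l *\<^sub>R x}"
    by (simp add: gram_eigenspace_def adjoint_orth_proj U orth_proj_ident orth_proj_mem)
  have lin: "linear (\<lambda>x. orth_proj V (orth_proj U x))"
    using linear_compose[OF linear_orth_proj[OF U] linear_orth_proj[OF B'(4)]] by (simp add: o_def)
  show ?thesis unfolding gram
  proof (intro equalityI subsetI)
    fix x assume x: "x \<in> {x \<in> V. orth_proj V (orth_proj U x) = l *\<^sub>R x}"
    show "x \<in> span ?E"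
    proof (rule in_span_orthonormal_subset[OF B'(1,2)])
      show "x \<in> span B" using x B'(3) by simp
      fix b assume b: "b \<in> B - ?E"
      have "l * (x \<bullet> b) = (norm (orth_proj U b))\<^sup>2 * (x \<bullet> b)"
        using compression_selfadjoint[OF U B'(4), of x b] x b B'(6,7) by auto
      then show "x \<bullet> b = 0" using b by auto
    qed auto
  next
    fix x assume "x \<in> span ?E"
    then have "orth_proj V (orth_proj U x) = l *\<^sub>R x"
      by (rule linear_eq_on[OF lin linear_scale_self]) (auto simp: B'(7))
    moreover have "x \<in> V"
      using \<open>x \<in> span ?E\<close> span_mono[of ?E B] B'(3) by auto
    ultimately show "x \<in> {x \<in> V. orth_proj V (orth_proj U x) = l *\<^sub>R x}" by simp
  qed
qed

text \<open>
  The intersection is contained in the eigenspace for the eigenvalue one, and a unit vector that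
  keeps its length under the projection onto \<open>U\<close> lies in \<open>U\<close>.
\<close>

lemma principal_basis_Int:
  assumes U: "subspace U" and B: "principal_basis U V B"
  shows "span (B \<inter> U) = U \<inter> V"
proof -
  note B' = principal_basisD[OF B]
  have "(norm (orth_proj U b))\<^sup>2 = 1 \<longleftrightarrow> b \<in> U" if b: "b \<in> B" for b
  proof -
    have "(norm (orth_proj U b))\<^sup>2 = 1 \<longleftrightarrow> norm (orth_proj U b) = norm b"
      using B'(2)[OF b] power2_eq_iff_nonneg[of "norm (orth_proj U b)" 1] by simp
    then show ?thesis by (simp only: norm_orth_proj_eq_iff[OF U])
  qed
  then have E: "{b \<in> B. (norm (orth_proj U b))\<^sup>2 = 1} = B \<inter> U" by auto
  have "U \<inter> V \<subseteq> gram_eigenspace (orth_proj U) V 1"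
    by (auto simp: gram_eigenspace_def adjoint_orth_proj U B'(4) orth_proj_ident)
  then have "U \<inter> V \<subseteq> span (B \<inter> U)"
    using gram_eigenspace_principal_basis[OF U B, of 1] E by simp
  moreover have "span (B \<inter> U) \<subseteq> U \<inter> V"
    using U B'(4,6) by (intro span_minimal subspace_inter) auto
  ultimately show ?thesis by blast
qed

text \<open>
  Each singular value \<open>\<sigma>\<close> is repeated as often as the dimension of its eigenspace, which is the number
  of basis vectors \<open>b\<close> with \<open>norm (P b) = \<sigma>\<close>.  So the multiset of singular values is the image of the
  basis under \<open>b \<mapsto> norm (P b)\<close>.
\<close>

lemma singular_values_principal_basis:
  assumes U: "subspace U" and B: "principal_basis U V B"
  shows "singular_values (orth_proj U) V =
    rev (sorted_list_of_multiset (image_mset (\<lambda>b. norm (orth_proj U b)) (mset_set B)))"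
proof -
  note B' = principal_basisD[OF B]
  let ?f = "\<lambda>b. norm (orth_proj U b)"
  let ?E = "\<lambda>\<sigma>. {b \<in> B. ?f b = \<sigma>}"
  have gram: "gram_eigenspace (orth_proj U) V (\<sigma>\<^sup>2) = span (?E \<sigma>)" if "0 \<le> \<sigma>" for \<sigma>
    unfolding gram_eigenspace_principal_basis[OF U B]
    using that by (intro arg_cong[of _ _ span] Collect_cong) (simp add: power2_eq_iff_nonneg)
  have dim: "dim (span (?E \<sigma>)) = card (?E \<sigma>)" for \<sigma>
    by (intro dim_span_eq_card_independent B'(8)) auto
  have nontrivial: "span (?E \<sigma>) \<noteq> {0} \<longleftrightarrow> \<sigma> \<in> ?f ` B" for \<sigma>
  proof -
    have "0 \<notin> ?E \<sigma>" using B'(2)[of 0] by auto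
    then have "?E \<sigma> = {}" if "span (?E \<sigma>) = {0}"
      using span_superset[of "?E \<sigma>"] unfolding that by blast
    moreover have "span (?E \<sigma>) = {0}" if "?E \<sigma> = {}"
      unfolding that by (rule span_empty)
    ultimately show ?thesis by blast
  qed
  have set_eq: "{\<sigma>. 0 \<le> \<sigma> \<and> gram_eigenspace (orth_proj U) V (\<sigma>\<^sup>2) \<noteq> {0}} = ?f ` B"
  proof -
    have "gram_eigenspace (orth_proj U) V (\<sigma>\<^sup>2) \<noteq> {0} \<longleftrightarrow> \<sigma> \<in> ?f ` B" if "0 \<le> \<sigma>" for \<sigma>
      unfolding gram[OF that] by (rule nontrivial)
    moreover have "?f ` B \<subseteq> {0..}" by auto
    ultimately show ?thesis by blast
  qed
  have "(\<Sum>\<sigma> | 0 \<le> \<sigma> \<and> gram_eigenspace (orth_proj U) V (\<sigma>\<^sup>2) \<noteq> {0}.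
          replicate_mset (dim (gram_eigenspace (orth_proj U) V (\<sigma>\<^sup>2))) \<sigma>)
        = (\<Sum>\<sigma>\<in>?f ` B. replicate_mset (card (?E \<sigma>)) \<sigma>)"
    unfolding set_eq by (intro sum.cong) (auto simp: gram dim simp del: dim_span)
  also have "\<dots> = image_mset ?f (mset_set B)"
  proof (rule multiset_eqI)
    fix \<sigma>
    have "count (\<Sum>\<tau>\<in>?f ` B. replicate_mset (card (?E \<tau>)) \<tau>) \<sigma> =
        (\<Sum>\<tau>\<in>?f ` B. if \<tau> = \<sigma> then card (?E \<sigma>) else 0)"
      unfolding count_sum by (intro sum.cong) auto
    also have "\<dots> = card (?E \<sigma>)"
      using B'(5) by (auto simp: card_eq_0_iff)
    also have "\<dots> = count (image_mset ?f (mset_set B)) \<sigma>"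
      using B'(5) by (simp add: count_image_mset' eq_commute[of \<sigma>])
    finally show "count (\<Sum>\<tau>\<in>?f ` B. replicate_mset (card (?E \<tau>)) \<tau>) \<sigma> =
        count (image_mset ?f (mset_set B)) \<sigma>" .
  qed
  finally show ?thesis unfolding singular_values_def by simp
qed

lemma sorted_list_of_multiset_add_le:
  assumes "\<And>x y. x \<in># M \<Longrightarrow> y \<in># N \<Longrightarrow> x \<le> y"
  shows "sorted_list_of_multiset (M + N) = sorted_list_of_multiset M @ sorted_list_of_multiset N"
proof -
  let ?xs = "sorted_list_of_multiset M @ sorted_list_of_multiset N"
  have "sorted_list_of_multiset (M + N) = sorted_list_of_multiset (mset ?xs)" by simp
  also have "\<dots> = sort ?xs" by (rule sorted_list_of_multiset_mset)
  also have "\<dots> = ?xs" using assms by (intro sorted_sort_id) (simp add: sorted_append)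
  finally show ?thesis .
qed

text \<open>
  For singular values, \<open>c = 1\<close> is the maximal value and \<open>s\<close> the dimension of the intersection.  Skipping
  the \<open>s\<close> copies of \<open>c\<close> leads to the largest of the remaining values.
\<close>

lemma decreasing_list_nth:
  fixes M :: "real multiset" and s :: nat
  assumes less: "\<And>x. x \<in># M \<Longrightarrow> x < c" and ne: "M \<noteq> {#}"
  defines "xs \<equiv> rev (sorted_list_of_multiset (M + replicate_mset s c))"
  shows "xs ! s = Max (set_mset M)" "xs ! (s + size M - 1) = Min (set_mset M)"
proof -
  define ys where "ys = sorted_list_of_multiset M"
  have ys: "sorted ys" "set ys = set_mset M" "length ys = size M" "ys \<noteq> []"
    using ne mset_sorted_list_of_multiset[of M]
    by (auto simp: ys_def simp del: mset_sorted_list_of_multiset simp flip: size_mset)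
  have rep: "sorted_list_of_multiset (replicate_mset s c) = replicate s c"
    using sorted_list_of_multiset_mset[of "replicate s c"] by (simp add: sorted_sort_id)
  have xs: "xs = replicate s c @ rev ys"
  proof -
    have "sorted_list_of_multiset (M + replicate_mset s c) =
        sorted_list_of_multiset M @ sorted_list_of_multiset (replicate_mset s c)"
      by (rule sorted_list_of_multiset_add_le) (auto dest!: less split: if_splits)
    then show ?thesis by (simp add: xs_def ys_def rep)
  qed
  have "xs ! s = last ys" using ys(4) by (simp add: xs nth_append hd_rev flip: hd_conv_nth)
  also have "\<dots> = Max (set ys)"
    using ys(1,4)
    by (cases ys rule: rev_cases) (auto simp: sorted_append intro!: Max_eqI[symmetric])
  finally show "xs ! s = Max (set_mset M)" using ys by simp
  have "0 < size M" using ne by (simp add: nonempty_has_size)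
  then have "\<not> s + size M - Suc 0 < s" by linarith
  then have "xs ! (s + size M - 1) = hd ys" using ys \<open>0 < size M\<close> by (simp add: xs nth_append rev_nth hd_conv_nth)
  also have "\<dots> = Min (set ys)"
    using ys(1,4) by (cases ys) (auto intro!: Min_eqI[symmetric])
  finally show "xs ! (s + size M - 1) = Min (set_mset M)" using ys by simp
qed

lemma sin_arccos_squared:
  assumes "0 \<le> (x::real)" "x \<le> 1"
  shows "(sin (arccos x))\<^sup>2 = 1 - x\<^sup>2"
  using assms by (simp add: sin_squared_eq)

text \<open>
  In a principal basis the cosines of the principal angles are the norms \<open>norm (P b)\<close>.  Those equal to
  one come from the vectors in \<open>U\<close>, and their number is the dimension of \<open>U \<inter> V\<close>.  The Friedrichs
  angle and the largest angle therefore belong to the largest and the smallest norm over the vectors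
  outside \<open>U\<close>, of which there are some because \<open>V\<close> is not contained in \<open>U\<close>.
\<close>

lemma friedrichs_and_largest_angle:
  assumes U: "subspace U" and VU: "\<not> V \<subseteq> U" and B: "principal_basis U V B"
  shows "(sin (friedrichs_angle U V))\<^sup>2 \<in> (\<lambda>b. 1 - (norm (orth_proj U b))\<^sup>2) ` (B - U)"
    and "(sin (largest_angle U V))\<^sup>2 \<in> (\<lambda>b. 1 - (norm (orth_proj U b))\<^sup>2) ` (B - U)"
    and "d \<in> B - U \<Longrightarrow> (sin (friedrichs_angle U V))\<^sup>2 \<le> 1 - (norm (orth_proj U d))\<^sup>2"
    and "d \<in> B - U \<Longrightarrow> 1 - (norm (orth_proj U d))\<^sup>2 \<le> (sin (largest_angle U V))\<^sup>2"
    and "0 < (sin (friedrichs_angle U V))\<^sup>2"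
proof -
  note B' = principal_basisD[OF B]
  define f where "f = (\<lambda>b. norm (orth_proj U b))"
  define D where "D = B - U"
  have fin: "finite D" "finite (f ` D)" using B'(5) by (simp_all add: D_def)
  have ne: "D \<noteq> {}"
  proof
    assume "D = {}"
    then have "span B \<subseteq> U" using U by (intro span_minimal) (auto simp: D_def)
    then show False using VU B'(3) by simp
  qed
  have f_less: "0 \<le> f d" "f d < 1" if "d \<in> D" for d
    using that norm_orth_proj_le[OF U, of d] norm_orth_proj_eq_iff[OF U, of d] B'(2)[of d]
    by (auto simp: f_def D_def)
  have f_one: "f b = 1" if "b \<in> B \<inter> U" for b
    using that by (simp add: f_def orth_proj_ident U B'(2))
  let ?M = "image_mset f (mset_set D)"
  have Bsplit: "B = D \<union> (B \<inter> U)" "D \<inter> (B \<inter> U) = {}" by (auto simp: D_def)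
  have "image_mset f (mset_set (B \<inter> U)) = replicate_mset (card (B \<inter> U)) 1"
    using B'(5) f_one by (subst image_mset_cong[where g = "\<lambda>_. 1"]) (auto simp: image_mset_const_eq)
  moreover have "mset_set B = mset_set D + mset_set (B \<inter> U)"
    using Bsplit fin B'(5) by (metis finite_Int mset_set_Union)
  moreover have s: "card (B \<inter> U) = dim (U \<inter> V)"
    by (metis B'(8) dim_span_eq_card_independent inf_le1 principal_basis_Int[OF U B])
  ultimately have sv: "singular_values (orth_proj U) V =
      rev (sorted_list_of_multiset (?M + replicate_mset (dim (U \<inter> V)) 1))"
    using singular_values_principal_basis[OF U B] by (simp add: f_def)
  have "card B = dim V"
    using dim_span_eq_card_independent[OF B'(8)[OF order_refl]] B'(3) by simp
  moreover have "card B = card D + card (B \<inter> U)"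
    using card_Un_disjoint[OF _ _ Bsplit(2)] Bsplit(1) B'(5) fin by simp
  ultimately have p: "dim V = dim (U \<inter> V) + size ?M" using s by simp
  have M: "x \<in># ?M \<Longrightarrow> x < 1" "?M \<noteq> {#}" "set_mset ?M = f ` D" for x
    using f_less fin ne by (auto simp: mset_set_empty_iff)
  note nth = decreasing_list_nth[OF M(1,2), of "dim (U \<inter> V)", folded sv p, unfolded M(3)]
  have angles: "friedrichs_angle U V = arccos (Max (f ` D))"
      "largest_angle U V = arccos (Min (f ` D))"
    using nth by (simp_all add: friedrichs_angle_def largest_angle_def principal_angle_def)
  obtain d1 where d1: "d1 \<in> D" "Max (f ` D) = f d1"
    using Max_in[OF fin(2)] ne by fastforce
  obtain d2 where d2: "d2 \<in> D" "Min (f ` D) = f d2"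
    using Min_in[OF fin(2)] ne by fastforce
  have sins: "(sin (friedrichs_angle U V))\<^sup>2 = 1 - (f d1)\<^sup>2" "(sin (largest_angle U V))\<^sup>2 = 1 - (f d2)\<^sup>2"
    using angles d1 d2 f_less sin_arccos_squared less_imp_le by metis+
  show "(sin (friedrichs_angle U V))\<^sup>2 \<in> (\<lambda>b. 1 - (norm (orth_proj U b))\<^sup>2) ` (B - U)"
       "(sin (largest_angle U V))\<^sup>2 \<in> (\<lambda>b. 1 - (norm (orth_proj U b))\<^sup>2) ` (B - U)"
    using sins d1(1) d2(1) by (auto simp: f_def D_def)
  show "0 < (sin (friedrichs_angle U V))\<^sup>2"
    using sins f_less[OF d1(1)] by (simp add: power_less_one_iff abs_square_less_1)
  assume d: "d \<in> B - U"
  have "f d \<le> f d1" "f d2 \<le> f d"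
    using d fin(2) by (simp_all add: D_def flip: d1(2) d2(2))
  then have "(f d)\<^sup>2 \<le> (f d1)\<^sup>2" "(f d2)\<^sup>2 \<le> (f d)\<^sup>2"
    by (simp_all add: f_def power_mono)
  then show "(sin (friedrichs_angle U V))\<^sup>2 \<le> 1 - (norm (orth_proj U d))\<^sup>2"
      "1 - (norm (orth_proj U d))\<^sup>2 \<le> (sin (largest_angle U V))\<^sup>2"
    by (simp_all add: sins) (simp_all add: f_def)
qed

section \<open>The dynamics of the relaxed operator\<close>

text \<open>
  Expanding the reflections gives this form.  Projected onto \<open>V\<close>, the last two terms merge into one
  with coefficient \<open>4 \<beta> + 2 (\<gamma> - \<beta>) = 2 (\<gamma> + \<beta>)\<close>, so that only the sum of the parameters remains.
\<close>

lemma C_op_eq: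
  assumes V: "subspace V" and v: "v \<in> V"
  shows "C_op U V \<gamma> \<beta> v = (1 - 2 * (\<gamma> + \<beta>)) *\<^sub>R v
    + (4 * \<beta>) *\<^sub>R orth_proj V (orth_proj U v) + (2 * (\<gamma> - \<beta>)) *\<^sub>R orth_proj U v"
proof -
  note lin = linear_orth_proj[OF V]
  have "orth_proj V (reflection U v) = 2 *\<^sub>R orth_proj V (orth_proj U v) - v"
    by (simp add: reflection_def linear_diff[OF lin] linear_cmul[OF lin] orth_proj_ident V v)
  then have eq: "C_op U V \<gamma> \<beta> v = (1 - \<gamma> - \<beta>) *\<^sub>R v
      + \<beta> *\<^sub>R (2 *\<^sub>R (2 *\<^sub>R orth_proj V (orth_proj U v) - v) - (2 *\<^sub>R orth_proj U v - v))
      + \<gamma> *\<^sub>R (2 *\<^sub>R orth_proj U v - v)"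
    by (simp add: C_op_def reflection_def[of V "reflection U v"]) (simp add: reflection_def)
  show ?thesis
    unfolding eq by (rule euclidean_eqI) (simp add: inner_add_left inner_diff_left algebra_simps)
qed

lemma linear_C_op:
  assumes U: "subspace U" and V: "subspace V"
  shows "linear (C_op U V \<gamma> \<beta>)"
proof -
  have refl: "linear (reflection W)" if "subspace W" for W :: "'a set"
    unfolding reflection_def[abs_def]
    by (intro linear_compose_sub linear_compose_scale_right linear_orth_proj that linear_ident)
  have "linear (\<lambda>x. reflection V (reflection U x))"
    using linear_compose[OF refl[OF U] refl[OF V]] by (simp add: o_def)
  then show ?thesis
    unfolding C_op_def[abs_def]
    by (intro linear_compose_add linear_compose_scale_right linear_ident refl U)
qed

lemma C_op_fixes_Int:
  assumes "subspace U" "subspace V" "x \<in> U \<inter> V"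
  shows "C_op U V \<gamma> \<beta> x = x"
proof -
  have "reflection U x = x" "reflection V x = x"
    using assms by (simp_all add: reflection_def orth_proj_ident scaleR_2)
  then show ?thesis by (simp add: C_op_def flip: scaleR_add_left)
qed

lemma proj_C_op_principal_vector:
  assumes U: "subspace U" and B: "principal_basis U V B" and b: "b \<in> B"
  shows "orth_proj V (C_op U V \<gamma> \<beta> b) = (1 - 2 * (\<gamma> + \<beta>) * (1 - (norm (orth_proj U b))\<^sup>2)) *\<^sub>R b"
proof -
  note B' = principal_basisD[OF B]
  note lin = linear_orth_proj[OF B'(4)]
  have QPb: "orth_proj V (orth_proj U b) = (norm (orth_proj U b))\<^sup>2 *\<^sub>R b" by (rule B'(7)[OF b])
  have bV: "orth_proj V b = b" by (rule orth_proj_ident[OF B'(4) B'(6)[OF b]])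
  show ?thesis
    unfolding C_op_eq[OF B'(4) B'(6)[OF b]] linear_add[OF lin] linear_cmul[OF lin] QPb bV
    by (simp add: algebra_simps flip: scaleR_add_left scaleR_diff_left)
qed

lemma proj_C_op_contracts:
  assumes U: "subspace U" and B: "principal_basis U V B" and w: "w \<in> span (B - U)"
    and \<rho>: "\<And>d. d \<in> B - U \<Longrightarrow> \<bar>1 - 2 * (\<gamma> + \<beta>) * (1 - (norm (orth_proj U d))\<^sup>2)\<bar> \<le> \<rho>"
    and \<rho>0: "0 \<le> \<rho>"
  shows "orth_proj V (C_op U V \<gamma> \<beta> w) \<in> span (B - U)"
    and "norm (orth_proj V (C_op U V \<gamma> \<beta> w)) \<le> \<rho> * norm w"
proof -
  note B' = principal_basisD[OF B]
  let ?S = "\<lambda>x. orth_proj V (C_op U V \<gamma> \<beta> x)"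
  let ?D = "B - U"
  let ?l = "\<lambda>d. 1 - 2 * (\<gamma> + \<beta>) * (1 - (norm (orth_proj U d))\<^sup>2)"
  have lin: "linear ?S"
    using linear_compose[OF linear_C_op[OF U B'(4)] linear_orth_proj[OF B'(4)]] by (simp add: o_def)
  have D: "pairwise orthogonal ?D" "\<And>d. d \<in> ?D \<Longrightarrow> norm d = 1"
    using B'(1,2) by (auto intro: pairwise_subset)
  have norm_sum: "(norm (\<Sum>d\<in>?D. c d *\<^sub>R d))\<^sup>2 = (\<Sum>d\<in>?D. (c d)\<^sup>2)" for c
    by (rule orthonormal_norm_sum[OF D])
  have w_eq: "w = (\<Sum>d\<in>?D. (w \<bullet> d) *\<^sub>R d)" by (rule orthonormal_expansion[OF D w])
  have "?S w = (\<Sum>d\<in>?D. (w \<bullet> d) *\<^sub>R ?S d)"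
    by (subst w_eq) (simp add: linear_sum[OF lin] linear_cmul[OF lin])
  also have "\<dots> = (\<Sum>d\<in>?D. ((w \<bullet> d) * ?l d) *\<^sub>R d)"
    by (intro sum.cong) (auto simp: proj_C_op_principal_vector[OF U B])
  finally have Sw: "?S w = (\<Sum>d\<in>?D. ((w \<bullet> d) * ?l d) *\<^sub>R d)" .
  show "?S w \<in> span ?D" unfolding Sw by (intro span_sum span_scale span_base)
  have "(norm (?S w))\<^sup>2 = (\<Sum>d\<in>?D. (w \<bullet> d)\<^sup>2 * (?l d)\<^sup>2)"
    unfolding Sw norm_sum by (simp only: power_mult_distrib)
  also have "\<dots> \<le> (\<Sum>d\<in>?D. (w \<bullet> d)\<^sup>2 * \<rho>\<^sup>2)"
    using \<rho> \<rho>0 by (intro sum_mono mult_left_mono) (auto simp flip: abs_le_square_iff)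
  also have "\<dots> = (\<rho> * norm w)\<^sup>2"
    using norm_sum[of "\<lambda>d. w \<bullet> d"] unfolding w_eq[symmetric]
    by (simp add: power_mult_distrib mult.commute[of "\<rho>\<^sup>2"] flip: sum_distrib_right)
  finally show "norm (?S w) \<le> \<rho> * norm w"
    by (rule power2_le_imp_le) (simp add: \<rho>0)
qed

text \<open>
  Both projections leave a residual orthogonal to \<open>U \<inter> V\<close>, hence so is their difference.  The basis vectors
  in \<open>U\<close> belong to \<open>U \<inter> V\<close>, so the difference has no component along them.
\<close>

lemma orth_proj_diff_in_span:
  assumes U: "subspace U" and B: "principal_basis U V B"
  shows "orth_proj V x - orth_proj (U \<inter> V) x \<in> span (B - U)"
proof -
  note B' = principal_basisD[OF B]
  have UV: "subspace (U \<inter> V)" by (simp add: U B'(4) subspace_inter)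
  show ?thesis
  proof (rule in_span_orthonormal_subset[OF B'(1,2)])
    show "orth_proj V x - orth_proj (U \<inter> V) x \<in> span B"
      using orth_proj_mem[OF UV] orth_proj_mem[OF B'(4)] B'(3,4) by (simp add: subspace_diff)
    fix b assume "b \<in> B - (B - U)"
    then have b: "b \<in> U \<inter> V" using B'(6) by auto
    then show "(orth_proj V x - orth_proj (U \<inter> V) x) \<bullet> b = 0"
      using orth_proj_residual[OF UV b, of x] orth_proj_residual[OF B'(4), of b x]
      by (simp add: inner_diff_left)
  qed auto
qed

text \<open>
  The error itself need not lie in \<open>V\<close>, since \<open>C\<close> need not map \<open>V\<close> into itself.  Its projection \<open>w\<close> onto \<open>V\<close> does, and it
  evolves by \<open>Q C\<close>.  The full error after one more step is \<open>C w\<close>, because \<open>C\<close> fixes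
  the limit.
\<close>

lemma L_op_pow_error:
  assumes U: "subspace U" and B: "principal_basis U V B"
    and \<rho>: "\<And>d. d \<in> B - U \<Longrightarrow> \<bar>1 - 2 * (\<gamma> + \<beta>) * (1 - (norm (orth_proj U d))\<^sup>2)\<bar> \<le> \<rho>"
    and \<rho>0: "0 \<le> \<rho>"
  defines "w \<equiv> \<lambda>k x. orth_proj V ((L_op U V \<gamma> \<beta> ^^ k) x) - orth_proj (U \<inter> V) x"
  shows "w k x \<in> span (B - U)" "norm (w k x) \<le> \<rho> ^ k * norm x"
    and "(L_op U V \<gamma> \<beta> ^^ Suc k) x - orth_proj (U \<inter> V) x = C_op U V \<gamma> \<beta> (w k x)"
proof -
  note B' = principal_basisD[OF B]
  have UV: "subspace (U \<inter> V)" by (simp add: U B'(4) subspace_inter)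
  note linQ = linear_orth_proj[OF B'(4)]
  show C: "(L_op U V \<gamma> \<beta> ^^ Suc k) x - orth_proj (U \<inter> V) x = C_op U V \<gamma> \<beta> (w k x)" for k
    using C_op_fixes_Int[OF U B'(4) orth_proj_mem[OF UV, of x], of \<gamma> \<beta>]
    by (simp add: w_def linear_diff[OF linear_C_op[OF U B'(4)]] L_op_def)
  have "orth_proj V (orth_proj (U \<inter> V) x) = orth_proj (U \<inter> V) x"
    using orth_proj_mem[OF UV, of x] B'(4) by (simp add: orth_proj_ident)
  then have step: "w (Suc k) x = orth_proj V (C_op U V \<gamma> \<beta> (w k x))" for k
    unfolding C[symmetric] linear_diff[OF linQ] by (simp add: w_def)
  have "w k x \<in> span (B - U) \<and> norm (w k x) \<le> \<rho> ^ k * norm x"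
  proof (induction k)
    case 0
    let ?y = "orth_proj V x"
    have "orth_proj (U \<inter> V) ?y = orth_proj (U \<inter> V) x"
    proof (rule orth_proj_eqI[OF UV orth_proj_mem[OF UV]])
      fix u assume "u \<in> U \<inter> V"
      then show "(?y - orth_proj (U \<inter> V) x) \<bullet> u = 0"
        using orth_proj_residual[OF UV, of u x] orth_proj_residual[OF B'(4), of u x]
        by (simp add: inner_diff_left)
    qed
    then have "(norm (?y - orth_proj (U \<inter> V) x))\<^sup>2 \<le> (norm ?y)\<^sup>2"
      using norm_orth_proj_pythagoras[OF UV, of ?y] by simp
    then have "norm (?y - orth_proj (U \<inter> V) x) \<le> norm x"
      using norm_orth_proj_le[OF B'(4), of x] by (simp add: abs_le_square_iff[symmetric])
    then show ?case using orth_proj_diff_in_span[OF U B, of x] by (simp add: w_def)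
  next
    case (Suc k)
    then have "norm (w (Suc k) x) \<le> \<rho> * norm (w k x)" "w (Suc k) x \<in> span (B - U)"
      unfolding step using proj_C_op_contracts[OF U B _ \<rho> \<rho>0] by auto
    moreover have "\<rho> * norm (w k x) \<le> \<rho> * (\<rho> ^ k * norm x)"
      using Suc \<rho>0 by (intro mult_left_mono) auto
    ultimately show ?case by (simp add: mult.assoc)
  qed
  then show "w k x \<in> span (B - U)" "norm (w k x) \<le> \<rho> ^ k * norm x" by auto
qed

lemma linear_L_op_error:
  assumes U: "subspace U" and V: "subspace V"
  shows "linear (\<lambda>x. (L_op U V \<gamma> \<beta> ^^ k) x - orth_proj (U \<inter> V) x)"
proof -
  have L: "linear (L_op U V \<gamma> \<beta>)"
    unfolding L_op_def by (intro linear_compose linear_C_op linear_orth_proj U V)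
  have "linear (L_op U V \<gamma> \<beta> ^^ k)"
  proof (induction k)
    case 0
    show ?case by (simp add: linear_id[unfolded id_def] id_def)
  next
    case (Suc k)
    then show ?case unfolding funpow.simps by (rule linear_compose[OF _ L])
  qed
  then show ?thesis
    by (intro linear_compose_sub linear_orth_proj subspace_inter U V)
qed

text \<open>
  The error after \<open>k + 1\<close> steps is at most \<open>c \<rho>\<^sup>k\<close> times the norm of the starting point, where \<open>c\<close>
  bounds \<open>C\<close>.  The missing factor \<open>\<rho>\<close> is absorbed into the constant if \<open>\<rho>\<close> is positive.  If \<open>\<rho>\<close> is zero,
  then the error vanishes from the second step on.
\<close>

lemma linear_conv_rate_upper:
  assumes U: "subspace U" and B: "principal_basis U V B"
    and \<rho>: "\<And>d. d \<in> B - U \<Longrightarrow> \<bar>1 - 2 * (\<gamma> + \<beta>) * (1 - (norm (orth_proj U d))\<^sup>2)\<bar> \<le> \<rho>"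
    and \<rho>0: "0 \<le> \<rho>" and \<rho>1: "\<rho> < 1"
  shows "linear_conv_rate (L_op U V \<gamma> \<beta>) (orth_proj (U \<inter> V)) \<rho>"
proof -
  note B' = principal_basisD[OF B]
  have bl: "bounded_linear (C_op U V \<gamma> \<beta>)"
    using linear_C_op[OF U B'(4)] by (simp add: linear_conv_bounded_linear)
  \<comment> \<open>The summand \<open>1\<close> makes the constant strictly positive, as the definition of a rate requires.\<close>
  define c where "c = onorm (C_op U V \<gamma> \<beta>) + 1"
  have c: "0 < c" "norm (C_op U V \<gamma> \<beta> y) \<le> c * norm y" for y
    using onorm_pos_le[OF bl] onorm[OF bl, of y] by (auto simp: c_def algebra_simps intro: order_trans)
  have err: "onorm (\<lambda>x. (L_op U V \<gamma> \<beta> ^^ Suc k) x - orth_proj (U \<inter> V) x) \<le> c * \<rho> ^ k" for k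
  proof (rule onorm_le)
    fix x
    let ?w = "orth_proj V ((L_op U V \<gamma> \<beta> ^^ k) x) - orth_proj (U \<inter> V) x"
    have "(L_op U V \<gamma> \<beta> ^^ Suc k) x - orth_proj (U \<inter> V) x = C_op U V \<gamma> \<beta> ?w"
      by (rule L_op_pow_error(3)[OF U B \<rho> \<rho>0])
    then have "norm ((L_op U V \<gamma> \<beta> ^^ Suc k) x - orth_proj (U \<inter> V) x) \<le> c * norm ?w"
      using c(2) by metis
    also have "\<dots> \<le> c * (\<rho> ^ k * norm x)"
      using L_op_pow_error(2)[OF U B \<rho> \<rho>0, where k=k and x=x] c(1) by (intro mult_left_mono) auto
    finally show "norm ((L_op U V \<gamma> \<beta> ^^ Suc k) x - orth_proj (U \<inter> V) x) \<le> c * \<rho> ^ k * norm x"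
      by (simp add: mult.assoc)
  qed
  have "\<exists>m>0. \<forall>k. c * \<rho> ^ Suc k \<le> m * \<rho> ^ Suc (Suc k)"
  proof (cases "\<rho> = 0")
    case True
    then show ?thesis by (intro exI[of _ 1]) auto
  next
    case False
    then show ?thesis using c \<rho>0 by (intro exI[of _ "c / \<rho>"]) auto
  qed
  then obtain m where m: "m > 0" "\<And>k. c * \<rho> ^ Suc k \<le> m * \<rho> ^ Suc (Suc k)" by blast
  have "onorm (\<lambda>x. (L_op U V \<gamma> \<beta> ^^ k) x - orth_proj (U \<inter> V) x) \<le> m * \<rho> ^ k" if k2: "k \<ge> 2" for k
  proof -
    obtain j where k: "k = Suc (Suc j)" using le_Suc_ex[OF k2] by auto
    show ?thesis unfolding k by (rule order_trans[OF err m(2)])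
  qed
  then show ?thesis unfolding linear_conv_rate_def using \<rho>0 \<rho>1 m(1) by blast
qed

text \<open>
  Starting from a principal vector \<open>d\<close> outside \<open>U\<close>, whose limit is zero, the projections of the iterates
  onto \<open>V\<close> are \<open>l\<^sup>k d\<close> with \<open>l\<close> the multiplier of \<open>d\<close>.  So the operator norm of the error is at least
  \<open>\<bar>l\<bar>\<^sup>k\<close>, which no multiple of \<open>r\<^sup>k\<close> with \<open>r < \<bar>l\<bar>\<close> can dominate.
\<close>

lemma linear_conv_rate_lower:
  assumes U: "subspace U" and B: "principal_basis U V B" and d: "d \<in> B - U"
    and r: "linear_conv_rate (L_op U V \<gamma> \<beta>) (orth_proj (U \<inter> V)) r"
  shows "\<bar>1 - 2 * (\<gamma> + \<beta>) * (1 - (norm (orth_proj U d))\<^sup>2)\<bar> \<le> r" (is "\<bar>?l\<bar> \<le> r")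
proof (rule ccontr)
  assume "\<not> \<bar>?l\<bar> \<le> r"
  then have less: "r < \<bar>?l\<bar>" by simp
  note B' = principal_basisD[OF B]
  have UV: "subspace (U \<inter> V)" by (simp add: U B'(4) subspace_inter)
  obtain m N where r0: "0 \<le> r" and m: "0 < m"
    and le: "\<And>k. k \<ge> N \<Longrightarrow> onorm (\<lambda>x. (L_op U V \<gamma> \<beta> ^^ k) x - orth_proj (U \<inter> V) x) \<le> m * r ^ k"
    using r unfolding linear_conv_rate_def by blast
  have "orth_proj (U \<inter> V) d = 0"
  proof (rule orth_proj_eqI[OF UV subspace_0[OF UV]])
    fix w assume "w \<in> U \<inter> V"
    then have "w \<in> span (B \<inter> U)" using principal_basis_Int[OF U B] by simp
    then show "(d - 0) \<bullet> w = 0"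
    proof (rule span_induct)
      show "subspace {w. (d - 0) \<bullet> w = 0}" by (rule subspace_hyperplane)
      fix b assume "b \<in> B \<inter> U"
      then show "(d - 0) \<bullet> b = 0" using d B'(1) by (auto simp: pairwise_def orthogonal_def)
    qed
  qed
  moreover have QL: "orth_proj V ((L_op U V \<gamma> \<beta> ^^ k) d) = ?l ^ k *\<^sub>R d" for k
  proof (induction k)
    case 0
    show ?case using d B'(4,6) by (simp add: orth_proj_ident)
  next
    case (Suc k)
    then show ?case
      using d proj_C_op_principal_vector[OF U B, of d \<gamma> \<beta>]
      by (simp add: L_op_def linear_cmul[OF linear_C_op[OF U B'(4)]]
          linear_cmul[OF linear_orth_proj[OF B'(4)]])
  qed
  ultimately have lower: "\<bar>?l\<bar> ^ k \<le> onorm (\<lambda>x. (L_op U V \<gamma> \<beta> ^^ k) x - orth_proj (U \<inter> V) x)" for k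
  proof -
    let ?e = "\<lambda>x. (L_op U V \<gamma> \<beta> ^^ k) x - orth_proj (U \<inter> V) x"
    have "\<bar>?l\<bar> ^ k = norm (orth_proj V ((L_op U V \<gamma> \<beta> ^^ k) d))"
      using d B'(2)[of d] by (simp add: QL power_abs)
    also have "\<dots> \<le> norm (?e d)"
      using norm_orth_proj_le[OF B'(4)] \<open>orth_proj (U \<inter> V) d = 0\<close> by simp
    also have "\<dots> \<le> onorm ?e * norm d"
      by (intro onorm linear_L_op_error[OF U B'(4), unfolded linear_conv_bounded_linear])
    finally show ?thesis using d B'(2)[of d] by simp
  qed
  show False
  proof (cases "r = 0")
    case True
    have "\<bar>?l\<bar> ^ Suc N \<le> m * r ^ Suc N" using lower le by (meson le_SucI order_refl order_trans)
    moreover have "0 < \<bar>?l\<bar> ^ Suc N" using less True by (intro zero_less_power) simp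
    ultimately show False using True by simp
  next
    case False
    then have "0 < r" using r0 by simp
    then obtain n where n: "m < (\<bar>?l\<bar> / r) ^ n"
      using less real_arch_pow[of "\<bar>?l\<bar> / r" m] by auto
    have "(\<bar>?l\<bar> / r) ^ n \<le> (\<bar>?l\<bar> / r) ^ (n + N)"
      using less \<open>0 < r\<close> by (intro power_increasing) auto
    with n have "m * r ^ (n + N) < (\<bar>?l\<bar> / r) ^ (n + N) * r ^ (n + N)"
      using \<open>0 < r\<close> by (intro mult_strict_right_mono) auto
    also have "\<dots> = \<bar>?l\<bar> ^ (n + N)" using \<open>0 < r\<close> by (simp add: power_divide)
    finally have "m * r ^ (n + N) < \<bar>?l\<bar> ^ (n + N)" .
    then show False using lower[of "n + N"] le[of "n + N"] by simp
  qed
qed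

lemma linear_conv_rate_imp_pointwise:
  assumes lin: "\<And>k. linear (\<lambda>x. (L ^^ k) x - L_inf x)" and r: "linear_conv_rate L L_inf r"
  shows "(\<lambda>k. (L ^^ k) x) \<longlonglongrightarrow> L_inf x"
proof -
  obtain m N where r01: "0 \<le> r" "r < 1"
    and le: "\<And>k. k \<ge> N \<Longrightarrow> onorm (\<lambda>x. (L ^^ k) x - L_inf x) \<le> m * r ^ k"
    using r unfolding linear_conv_rate_def by blast
  have "norm ((L ^^ k) x - L_inf x) \<le> m * r ^ k * norm x" if "k \<ge> N" for k
  proof -
    have "norm ((L ^^ k) x - L_inf x) \<le> onorm (\<lambda>x. (L ^^ k) x - L_inf x) * norm x"
      by (intro onorm lin[unfolded linear_conv_bounded_linear])
    also have "\<dots> \<le> m * r ^ k * norm x" using le[OF that] by (intro mult_right_mono) auto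
    finally show ?thesis .
  qed
  then have "\<forall>\<^sub>F k in sequentially. norm ((L ^^ k) x - L_inf x) \<le> m * r ^ k * norm x"
    by (auto simp: eventually_sequentially)
  moreover have "(\<lambda>k. m * r ^ k * norm x) \<longlonglongrightarrow> 0"
    using r01 by (intro tendsto_mult_left_zero tendsto_mult_right_zero LIMSEQ_power_zero) auto
  ultimately have "(\<lambda>k. (L ^^ k) x - L_inf x) \<longlonglongrightarrow> 0"
    by (rule Lim_null_comparison)
  then show ?thesis by (simp add: LIM_zero_iff)
qed

lemma abs_affine_le_max:
  fixes c :: real
  assumes "a \<le> t" "t \<le> b"
  shows "\<bar>1 - c * t\<bar> \<le> max \<bar>1 - c * a\<bar> \<bar>1 - c * b\<bar>"
proof (cases "0 \<le> c")
  case True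
  then have "c * a \<le> c * t" "c * t \<le> c * b" using assms by (simp_all add: mult_left_mono)
  then show ?thesis by linarith
next
  case False
  then have "c * t \<le> c * a" "c * b \<le> c * t" using assms by (simp_all add: mult_left_mono_neg)
  then show ?thesis by linarith
qed

text \<open>
  The second hypothesis on the parameters says that \<open>1 - 2 \<mu> t > -1\<close> at the largest squared sine \<open>t\<close>.
  It holds for \<open>\<mu> < 1\<close>, but also for the optimal \<open>\<mu>\<close> when that exceeds one.
\<close>

lemma L_op_optimal_rate:
  assumes U: "subspace U" and V: "subspace V" and VU: "\<not> V \<subseteq> U"
    and pos: "0 < \<gamma> + \<beta>" and less: "(\<gamma> + \<beta>) * (sin (largest_angle U V))\<^sup>2 < 1"
  shows "(\<lambda>k. (L_op U V \<gamma> \<beta> ^^ k) x) \<longlonglongrightarrow> orth_proj (U \<inter> V) x"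
    and "has_optimal_rate (L_op U V \<gamma> \<beta>) (orth_proj (U \<inter> V)) (Gamma_circ U V (\<gamma> + \<beta>))"
proof -
  obtain B where B: "principal_basis U V B" using principal_basis_exists[OF U V] .
  note angles = friedrichs_and_largest_angle[OF U VU B]
  define a b where "a = (sin (friedrichs_angle U V))\<^sup>2" and "b = (sin (largest_angle U V))\<^sup>2"
  define \<mu> where "\<mu> = \<gamma> + \<beta>"
  let ?\<Gamma> = "Gamma_circ U V \<mu>"
  have \<Gamma>: "?\<Gamma> = max \<bar>1 - 2 * \<mu> * a\<bar> \<bar>1 - 2 * \<mu> * b\<bar>"
    by (simp add: Gamma_circ_def a_def b_def)
  have ab: "0 < a" "a \<le> b"
    using angles(1,4,5) by (auto simp: a_def b_def)
  have "\<mu> * a \<le> \<mu> * b" "0 < \<mu> * a" "\<mu> * b < 1"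
    using ab pos less by (simp_all add: \<mu>_def b_def mult_left_mono)
  then have "\<bar>1 - 2 * \<mu> * a\<bar> < 1" "\<bar>1 - 2 * \<mu> * b\<bar> < 1"
    unfolding mult.assoc abs_less_iff by linarith+
  then have \<Gamma>1: "0 \<le> ?\<Gamma>" "?\<Gamma> < 1" unfolding \<Gamma> by (simp_all add: le_max_iff_disj)
  have up: "linear_conv_rate (L_op U V \<gamma> \<beta>) (orth_proj (U \<inter> V)) ?\<Gamma>"
  proof (rule linear_conv_rate_upper[OF U B _ \<Gamma>1])
    fix d assume d: "d \<in> B - U"
    show "\<bar>1 - 2 * (\<gamma> + \<beta>) * (1 - (norm (orth_proj U d))\<^sup>2)\<bar> \<le> ?\<Gamma>"
      unfolding \<Gamma> \<mu>_def[symmetric] using angles(3,4)[OF d]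
      by (intro abs_affine_le_max) (simp_all add: a_def b_def)
  qed
  have low: "?\<Gamma> \<le> r" if r: "linear_conv_rate (L_op U V \<gamma> \<beta>) (orth_proj (U \<inter> V)) r" for r
  proof -
    have "\<bar>1 - 2 * \<mu> * t\<bar> \<le> r" if "t \<in> (\<lambda>d. 1 - (norm (orth_proj U d))\<^sup>2) ` (B - U)" for t
    proof -
      from that obtain d where d: "d \<in> B - U" "t = 1 - (norm (orth_proj U d))\<^sup>2" by (rule imageE)
      show ?thesis using linear_conv_rate_lower[OF U B d(1) r] unfolding d(2) \<mu>_def .
    qed
    then show ?thesis unfolding \<Gamma> a_def b_def using angles(1,2) by simp
  qed
  show "(\<lambda>k. (L_op U V \<gamma> \<beta> ^^ k) x) \<longlonglongrightarrow> orth_proj (U \<inter> V) x"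
    by (rule linear_conv_rate_imp_pointwise[OF linear_L_op_error[OF U V] up])
  have "Inf {r. linear_conv_rate (L_op U V \<gamma> \<beta>) (orth_proj (U \<inter> V)) r} = ?\<Gamma>"
    using up low by (intro cInf_eq_minimum) auto
  then show "has_optimal_rate (L_op U V \<gamma> \<beta>) (orth_proj (U \<inter> V)) (Gamma_circ U V (\<gamma> + \<beta>))"
    using up unfolding has_optimal_rate_def \<mu>_def by auto
qed

section \<open>Minimising the rate\<close>

lemma equioscillation_value:
  fixes a b :: real
  assumes "0 < a" "a \<le> b"
  shows "max \<bar>1 - 2 * (1 / (a + b)) * a\<bar> \<bar>1 - 2 * (1 / (a + b)) * b\<bar> = (b - a) / (b + a)"
proof -
  have "1 - 2 * (1 / (a + b)) * a = (b - a) / (b + a)"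
    "1 - 2 * (1 / (a + b)) * b = - ((b - a) / (b + a))"
    using assms by (simp_all add: field_simps)
  moreover have "0 \<le> (b - a) / (b + a)" using assms by simp
  ultimately show ?thesis by (simp only: abs_minus_cancel abs_of_nonneg max.idem)
qed

text \<open>
  The average of \<open>1 - 2 \<mu> a\<close> and \<open>- (1 - 2 \<mu> b)\<close> with weights proportional to \<open>b\<close> and \<open>a\<close> does not depend
  on \<open>\<mu>\<close>; it equals the left-hand side.
\<close>

lemma equioscillation_minimal:
  fixes a b :: real
  assumes "0 < a" "a \<le> b"
  shows "(b - a) / (b + a) \<le> max \<bar>1 - 2 * \<mu> * a\<bar> \<bar>1 - 2 * \<mu> * b\<bar>" (is "_ \<le> ?M")
proof -
  have "b * (1 - 2 * \<mu> * a) \<le> b * ?M" "a * (2 * \<mu> * b - 1) \<le> a * ?M"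
    using assms by (intro mult_left_mono; linarith)+
  then have "b - a \<le> ?M * (b + a)" by (simp add: algebra_simps)
  then show ?thesis using assms by (simp add: pos_divide_le_eq)
qed

theorem theorem6p25:
  fixes U V :: "(real ^ 'n) set"
  assumes "subspace U" and "subspace V" and "\<not> V \<subseteq> U"
  shows "let a = (sin (friedrichs_angle U V))\<^sup>2;
             b = (sin (largest_angle U V))\<^sup>2;
             \<mu>_star = 1 / (a + b);
             \<rho>_V = (b - a) / (b + a)
         in
           (\<forall>\<gamma> \<beta>. \<gamma> + \<beta> \<in> {0<..<1} \<longrightarrow>
              (\<forall>x. (\<lambda>k. (L_op U V \<gamma> \<beta> ^^ k) x) \<longlonglongrightarrow> orth_proj (U \<inter> V) x) \<and>
              has_optimal_rate (L_op U V \<gamma> \<beta>) (orth_proj (U \<inter> V)) (Gamma_circ U V (\<gamma> + \<beta>))) \<and>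
           (\<mu>_star \<in> {0<..<1} \<longrightarrow>
              is_arg_min (Gamma_circ U V) (\<lambda>\<mu>. \<mu> \<in> {0<..<1}) \<mu>_star) \<and>
           is_arg_min (Gamma_circ U V) (\<lambda>\<mu>. \<mu> \<in> {0<..}) \<mu>_star \<and>
           Gamma_circ U V \<mu>_star = \<rho>_V \<and>
           (\<forall>\<gamma> \<beta>. \<gamma> + \<beta> = \<mu>_star \<longrightarrow>
              (\<forall>x. (\<lambda>k. (L_op U V \<gamma> \<beta> ^^ k) x) \<longlonglongrightarrow> orth_proj (U \<inter> V) x) \<and>
              has_optimal_rate (L_op U V \<gamma> \<beta>) (orth_proj (U \<inter> V)) \<rho>_V) \<and>
           has_optimal_rate (L_op U V (1 / (2 * (a + b))) (1 / (2 * (a + b))))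
             (orth_proj (U \<inter> V)) \<rho>_V"
proof -
  define a b where "a = (sin (friedrichs_angle U V))\<^sup>2" and "b = (sin (largest_angle U V))\<^sup>2"
  define \<mu> where "\<mu> = 1 / (a + b)"
  define \<rho> where "\<rho> = (b - a) / (b + a)"
  obtain B where B: "principal_basis U V B"
    using principal_basis_exists[OF assms(1,2)] .
  have ab: "0 < a" "a \<le> b"
    using friedrichs_and_largest_angle(1,4,5)[OF assms(1,3) B] by (auto simp: a_def b_def)
  have b1: "b \<le> 1" by (simp add: b_def abs_square_le_1)
  have \<Gamma>: "Gamma_circ U V t = max \<bar>1 - 2 * t * a\<bar> \<bar>1 - 2 * t * b\<bar>" for t
    by (simp add: Gamma_circ_def a_def b_def)
  have \<Gamma>\<mu>: "Gamma_circ U V \<mu> = \<rho>"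
    unfolding \<Gamma> \<mu>_def \<rho>_def by (rule equioscillation_value[OF ab])
  have min: "Gamma_circ U V \<mu> \<le> Gamma_circ U V t" for t
    unfolding \<Gamma>\<mu> unfolding \<Gamma> \<rho>_def by (rule equioscillation_minimal[OF ab])
  have argmin: "is_arg_min (Gamma_circ U V) P \<mu>" if "P \<mu>" for P
    using that min by (simp add: is_arg_min_linorder)
  have \<mu>0: "0 < \<mu>" and \<mu>b: "\<mu> * b < 1" using ab by (simp_all add: \<mu>_def)
  have conv: "(\<forall>x. (\<lambda>k. (L_op U V \<gamma> \<beta> ^^ k) x) \<longlonglongrightarrow> orth_proj (U \<inter> V) x) \<and>
      has_optimal_rate (L_op U V \<gamma> \<beta>) (orth_proj (U \<inter> V)) (Gamma_circ U V (\<gamma> + \<beta>))"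
    if "0 < \<gamma> + \<beta>" "(\<gamma> + \<beta>) * b < 1" for \<gamma> \<beta>
    using L_op_optimal_rate[OF assms that[unfolded b_def]] by blast
  have interval: "(\<gamma> + \<beta>) * b < 1" if "\<gamma> + \<beta> \<in> {0<..<1}" for \<gamma> \<beta> :: real
  proof -
    have "0 \<le> \<gamma> + \<beta>" "\<gamma> + \<beta> < 1" using that by simp_all
    then show ?thesis using mult_left_le[OF b1] le_less_trans by blast
  qed
  have star: "(\<forall>x. (\<lambda>k. (L_op U V \<gamma> \<beta> ^^ k) x) \<longlonglongrightarrow> orth_proj (U \<inter> V) x) \<and>
      has_optimal_rate (L_op U V \<gamma> \<beta>) (orth_proj (U \<inter> V)) \<rho>" if "\<gamma> + \<beta> = \<mu>" for \<gamma> \<beta>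
    using conv[of \<gamma> \<beta>] that \<mu>0 \<mu>b \<Gamma>\<mu> by simp
  have half: "1 / (2 * (a + b)) + 1 / (2 * (a + b)) = \<mu>"
    using ab by (simp add: \<mu>_def field_simps)
  show ?thesis
    unfolding Let_def a_def[symmetric] b_def[symmetric] \<mu>_def[symmetric] \<rho>_def[symmetric]
  proof (intro conjI)
    show "\<forall>\<gamma> \<beta>. \<gamma> + \<beta> \<in> {0<..<1} \<longrightarrow>
        (\<forall>x. (\<lambda>k. (L_op U V \<gamma> \<beta> ^^ k) x) \<longlonglongrightarrow> orth_proj (U \<inter> V) x) \<and>
        has_optimal_rate (L_op U V \<gamma> \<beta>) (orth_proj (U \<inter> V)) (Gamma_circ U V (\<gamma> + \<beta>))"
    proof (intro allI impI)
      fix \<gamma> \<beta> :: real assume "\<gamma> + \<beta> \<in> {0<..<1}"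
      then show "(\<forall>x. (\<lambda>k. (L_op U V \<gamma> \<beta> ^^ k) x) \<longlonglongrightarrow> orth_proj (U \<inter> V) x) \<and>
          has_optimal_rate (L_op U V \<gamma> \<beta>) (orth_proj (U \<inter> V)) (Gamma_circ U V (\<gamma> + \<beta>))"
        by (intro conv interval) simp
    qed
    show "\<mu> \<in> {0<..<1} \<longrightarrow> is_arg_min (Gamma_circ U V) (\<lambda>\<mu>. \<mu> \<in> {0<..<1}) \<mu>"
      by (intro impI argmin)
    show "is_arg_min (Gamma_circ U V) (\<lambda>\<mu>. \<mu> \<in> {0<..}) \<mu>"
      by (intro argmin) (simp add: \<mu>0)
    show "Gamma_circ U V \<mu> = \<rho>" by (rule \<Gamma>\<mu>)
    show "\<forall>\<gamma> \<beta>. \<gamma> + \<beta> = \<mu> \<longrightarrow>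
        (\<forall>x. (\<lambda>k. (L_op U V \<gamma> \<beta> ^^ k) x) \<longlonglongrightarrow> orth_proj (U \<inter> V) x) \<and>
        has_optimal_rate (L_op U V \<gamma> \<beta>) (orth_proj (U \<inter> V)) \<rho>"
      using star by blast
    show "has_optimal_rate (L_op U V (1 / (2 * (a + b))) (1 / (2 * (a + b)))) (orth_proj (U \<inter> V)) \<rho>"
      using star[OF half] by (rule conjunct2)
  qed
qed

end
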